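(* Let $\lambda$ be a nonzero real number. For all integers $m,n\ge 0$, the following identity of polynomials in $x$ holds: $$H_{n+m,\lambda}(x)=\sum_{k=0}^{n}\sum_{j=0}^{m}\binom{n}{k}H_{k,\lambda}(x)H_{\lambda}(m,j)\langle j+m\lambda\rangle_{n-k,\lambda}\, x^{j}.$$
   Context: For $\lambda\in\mathbb{R}$, $\lambda\neq 0$: $\langle x\rangle_{0,\lambda}=1$, $\langle x\rangle_{n,\lambda}=x(x+\lambda)\cdots(x+(n-1)\lambda)$ for $n\ge 1$. The falling factorial is $(x)_0=1$, $(x)_n=x(x-1)\cdots(x-n+1)$ for $n\ge 1$. The heterogeneous Stirling numbers of the second kind $H_\lambda(n,k)$ are defined by the polynomial identity $\langle x\rangle_{n,\lambda}=\sum_{k=0}^{n}H_{\lambda}(n,k)(x)_{k}$ for $n\ge 0$, with $H_\lambda(n,k)=0$ for $k<0$ or $n<k$. The heterogeneous Bell polynomials are $H_{n,\lambda}(x)=\sum_{k=0}^{n}H_{\lambda}(n,k)x^{k}$, $n\ge 0$. *)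

theory Defs
  imports Complex_Main "HOL-Computational_Algebra.Polynomial"
begin

definition degen_rising :: "'a::comm_ring_1 \<Rightarrow> 'a \<Rightarrow> nat \<Rightarrow> 'a" where
  "degen_rising l x n = (\<Prod>i<n. x + of_nat i * l)"

definition falling :: "'a::comm_ring_1 \<Rightarrow> nat \<Rightarrow> 'a" where
  "falling x n = (\<Prod>i<n. x - of_nat i)"

text \<open>
  The defining property is an identity in \<open>\<real>[x]\<close>: the indeterminate is \<open>[:0, 1:]\<close>,
  and \<open>[:l:]\<close> is \<open>l\<close> as a constant polynomial. The lower index is a natural number,
  so the convention for \<open>k < 0\<close> is not needed.
\<close>

definition is_hetero_Stirling :: "real \<Rightarrow> (nat \<Rightarrow> nat \<Rightarrow> real) \<Rightarrow> bool" where
  "is_hetero_Stirling l H \<longleftrightarrow>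
     (\<forall>n. degen_rising [:l:] [:0, 1:] n = (\<Sum>k\<le>n. smult (H n k) (falling [:0, 1:] k))) \<and>
     (\<forall>n k. n < k \<longrightarrow> H n k = 0)"

text \<open>The description below is proper: see \<open>hetero_Stirling_ex1\<close>.\<close>

definition hetero_Stirling :: "real \<Rightarrow> nat \<Rightarrow> nat \<Rightarrow> real" where
  "hetero_Stirling l = (THE H. is_hetero_Stirling l H)"

definition hetero_Bell :: "real \<Rightarrow> nat \<Rightarrow> real poly" where
  "hetero_Bell l n = (\<Sum>k\<le>n. monom (hetero_Stirling l n k) k)"

lemma falling_poly_degree_lead:
  "degree (falling [:0, 1::real:] n) = n \<and> coeff (falling [:0, 1::real:] n) n = 1"
proof (induction n)
  case 0
  show ?case by (simp add: falling_def)
next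
  case (Suc n)
  have eq: "falling [:0, 1::real:] (Suc n) = falling [:0, 1:] n * [:- real n, 1:]"
    by (simp add: falling_def of_nat_poly)
  have nz: "falling [:0, 1::real:] n \<noteq> 0"
    using Suc by (metis coeff_0 zero_neq_one)
  have d: "degree (falling [:0, 1::real:] (Suc n)) = Suc n"
    unfolding eq using Suc nz by (subst degree_mult_eq) auto
  have "lead_coeff (falling [:0, 1::real:] (Suc n)) = 1"
    unfolding eq lead_coeff_mult using Suc by simp
  with d show ?case by simp
qed

lemma falling_poly_independent:
  assumes "(\<Sum>k\<le>n. smult (c k) (falling [:0, 1::real:] k)) = 0" and "k \<le> n"
  shows "c k = 0"
  using assms
proof (induction n arbitrary: k)
  case 0
  then show ?case by (simp add: falling_def)
next
  case (Suc n)
  have "coeff (\<Sum>k\<le>Suc n. smult (c k) (falling [:0, 1::real:] k)) (Suc n) = c (Suc n)"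
    using falling_poly_degree_lead by (simp add: coeff_sum coeff_eq_0)
  then have z: "c (Suc n) = 0"
    unfolding Suc.prems(1) by simp
  then have "(\<Sum>k\<le>n. smult (c k) (falling [:0, 1::real:] k)) = 0"
    using Suc.prems(1) by simp
  with Suc.IH z Suc.prems(2) show ?case
    by (cases "k = Suc n") auto
qed

lemma degen_rising_falling_expansion:
  "\<exists>c. degen_rising [:l:] [:0, 1::real:] n = (\<Sum>k\<le>n. smult (c k) (falling [:0, 1:] k))"
proof (induction n)
  case 0
  show ?case by (rule exI[of _ "\<lambda>_. 1"]) (simp add: degen_rising_def falling_def)
next
  case (Suc n)
  then obtain c where c:
    "degen_rising [:l:] [:0, 1::real:] n = (\<Sum>k\<le>n. smult (c k) (falling [:0, 1:] k))"
    by blast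
  let ?F = "\<lambda>k. falling [:0, 1::real:] k"
  define a where "a k = (if k \<le> n then c k * (real k + real n * l) else 0)" for k
  define b where "b k = (case k of 0 \<Rightarrow> 0 | Suc j \<Rightarrow> c j)" for k
  have step: "smult (c k) (?F k) * [:real n * l, 1:]
      = smult (b (Suc k)) (?F (Suc k)) + smult (a k) (?F k)" if "k \<le> n" for k
  proof -
    have "[:real n * l, 1:] = [:- real k, 1:] + [:real k + real n * l:]" by simp
    moreover have "?F (Suc k) = ?F k * [:- real k, 1:]"
      by (simp add: falling_def of_nat_poly)
    ultimately show ?thesis using that
      by (simp only: distrib_left a_def b_def) (simp add: algebra_simps)
  qed
  have "degen_rising [:l:] [:0, 1::real:] (Suc n)
      = degen_rising [:l:] [:0, 1:] n * [:real n * l, 1:]"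
    by (simp add: degen_rising_def of_nat_poly mult.commute)
  also have "\<dots> = (\<Sum>k\<le>n. smult (b (Suc k)) (?F (Suc k)) + smult (a k) (?F k))"
    unfolding c sum_distrib_right by (rule sum.cong) (use step in auto)
  also have "\<dots> = (\<Sum>k\<le>Suc n. smult (b k) (?F k)) + (\<Sum>k\<le>Suc n. smult (a k) (?F k))"
    unfolding sum.distrib
    by (subst sum.atMost_Suc_shift) (simp add: a_def b_def)
  also have "\<dots> = (\<Sum>k\<le>Suc n. smult (b k + a k) (?F k))"
    by (simp only: smult_add_left sum.distrib)
  finally show ?case by (rule exI[of _ "\<lambda>k. b k + a k"])
qed

lemma hetero_Stirling_ex1: "\<exists>!H. is_hetero_Stirling l H"
proof (rule ex_ex1I)
  from degen_rising_falling_expansion[of l] obtain c where c: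
    "\<And>n. degen_rising [:l:] [:0, 1:] n = (\<Sum>k\<le>n. smult (c n k) (falling [:0, 1:] k))"
    by metis
  have "is_hetero_Stirling l (\<lambda>n k. if k \<le> n then c n k else 0)"
    unfolding is_hetero_Stirling_def c by simp
  then show "\<exists>H. is_hetero_Stirling l H" by blast
next
  fix H H'
  assume H: "is_hetero_Stirling l H" and H': "is_hetero_Stirling l H'"
  have "H n k = H' n k" for n k
  proof (cases "k \<le> n")
    case True
    have "(\<Sum>k\<le>n. smult (H n k - H' n k) (falling [:0, 1:] k)) = 0"
      using H H' unfolding is_hetero_Stirling_def
      by (simp add: smult_diff_left sum_subtractf)
    from falling_poly_independent[OF this True] show ?thesis by simp
  next
    case False
    then show ?thesis using H H' by (simp add: is_hetero_Stirling_def)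
  qed
  then show "H = H'" by (intro ext)
qed

lemma hetero_Stirling_spec: "is_hetero_Stirling l (hetero_Stirling l)"
  unfolding hetero_Stirling_def by (rule theI'[OF hetero_Stirling_ex1])

end

theory Submission
  imports Defs "HOL-Computational_Algebra.Polynomial_FPS"
begin

text \<open>
  Let \<open>L\<close> be the linear map on polynomials sending \<open>(x)\<^sub>k\<close> to \<open>x\<^sup>k\<close>, so that it sends
  the rising factorial of order \<open>n\<close> to the \<open>n\<close>-th Bell polynomial. Since
  \<open>(x)\<^sub>j (x - j)\<^sub>i = (x)\<^sub>i\<^sub>+\<^sub>j\<close>, multiplying by \<open>(x)\<^sub>j\<close> before \<open>L\<close> amounts to shifting the
  argument by \<open>j\<close> and multiplying by \<open>x\<^sup>j\<close> after it. Splitting the rising factorial of order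
  \<open>n + m\<close> as that of order \<open>m\<close> times a shifted one of order \<open>n\<close>, expanding the former in
  falling factorials and the latter by Vandermonde's identity gives the claim.
  By Dobinski's formula \<open>e\<^sup>x L(p)(x)\<close> is the exponential generating function of the values
  \<open>p(0), p(1), \<dots>\<close>, and it is in this form that \<open>L\<close> is used.
\<close>

definition egf :: "(real \<Rightarrow> real) \<Rightarrow> real fps" where
  "egf f = Abs_fps (\<lambda>i. f (real i) / fact i)"

lemma egf_cmult: "egf (\<lambda>x. c * f x) = fps_const c * egf f"
  by (rule fps_ext) (simp add: egf_def)

lemma egf_sum: "egf (\<lambda>x. \<Sum>k\<in>A. f k x) = (\<Sum>k\<in>A. egf (f k))"
  by (rule fps_ext) (simp add: egf_def fps_sum_nth sum_divide_distrib)

lemma falling_of_nat_less: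
  assumes "i < j"
  shows "falling (of_nat i :: 'a::comm_ring_1) j = 0"
  using assms by (auto simp: falling_def intro!: prod_zero)

lemma falling_of_nat_add:
  "falling (of_nat (i + j) :: real) j = fact (i + j) / fact i"
proof (induction j)
  case 0
  show ?case by (simp add: falling_def)
next
  case (Suc j)
  have "falling (real (i + Suc j)) (Suc j)
      = real (i + Suc j) * (\<Prod>k<j. real (i + Suc j) - real (Suc k))"
    by (simp only: falling_def prod.lessThan_Suc_shift) simp
  also have "(\<Prod>k<j. real (i + Suc j) - real (Suc k)) = falling (real (i + j)) j"
    by (simp add: falling_def)
  finally show ?case
    unfolding Suc by (simp add: add_divide_distrib algebra_simps)
qed

text \<open>At a natural number i, \<open>falling i j / fact i\<close> is 0 if i < j and
  \<open>1 / fact (i - j)\<close> otherwise, so the coefficients move up by j places.\<close>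

lemma egf_falling_mult:
  "egf (\<lambda>x. falling x j * f x) = fps_X ^ j * egf (\<lambda>x. f (x + real j))"
proof (rule fps_ext)
  fix i
  show "fps_nth (egf (\<lambda>x. falling x j * f x)) i =
      fps_nth (fps_X ^ j * egf (\<lambda>x. f (x + real j))) i"
  proof (cases "i < j")
    case True
    then show ?thesis
      using falling_of_nat_less[OF True, where 'a = real]
      by (simp add: egf_def fps_X_power_mult_nth)
  next
    case False
    then obtain d where "i = d + j" by (metis add.commute le_Suc_ex not_less)
    then show ?thesis
      using falling_of_nat_add[of d j]
      by (simp add: egf_def fps_X_power_mult_nth del: of_nat_add) (simp add: field_simps)
  qed
qed

lemma degen_rising_add:
  "degen_rising l x (m + n) = degen_rising l x m * degen_rising l (x + of_nat m * l) n"
  by (induction n) (simp_all add: degen_rising_def algebra_simps)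

lemma degen_rising_conv_pochhammer:
  fixes l :: "'a::field"
  assumes "l \<noteq> 0"
  shows "degen_rising l x n = l ^ n * pochhammer (x / l) n"
  using assms by (induction n) (simp_all add: degen_rising_def pochhammer_Suc field_simps)

text \<open>Rescaling by \<open>l\<close> reduces this to Vandermonde's identity for
  \<open>pochhammer\<close>.\<close>

lemma degen_rising_binomial_sum:
  fixes l :: "'a::field_char_0"
  assumes "l \<noteq> 0"
  shows "degen_rising l (x + y) n =
    (\<Sum>k\<le>n. of_nat (n choose k) * degen_rising l x k * degen_rising l y (n - k))"
proof -
  have "degen_rising l (x + y) n = (\<Sum>k\<le>n. l ^ n *
      (of_nat (n choose k) * pochhammer (x / l) k * pochhammer (y / l) (n - k)))"
    by (simp add: degen_rising_conv_pochhammer[OF assms] add_divide_distrib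
        pochhammer_binomial_sum sum_distrib_left)
  also have "\<dots> = (\<Sum>k\<le>n. of_nat (n choose k) * degen_rising l x k * degen_rising l y (n - k))"
  proof (rule sum.cong[OF refl])
    fix k assume "k \<in> {..n}"
    then have "l ^ n = l ^ k * l ^ (n - k)" by (simp flip: power_add)
    then show "l ^ n * (of_nat (n choose k) * pochhammer (x / l) k * pochhammer (y / l) (n - k))
        = of_nat (n choose k) * degen_rising l x k * degen_rising l y (n - k)"
      by (simp add: degen_rising_conv_pochhammer[OF assms] mult_ac)
  qed
  finally show ?thesis .
qed

lemma poly_falling: "poly (falling p k) x = falling (poly p x) k"
  by (simp add: falling_def poly_prod)

lemma poly_degen_rising: "poly (degen_rising [:l:] p n) x = degen_rising l (poly p x) n"
  by (simp add: degen_rising_def poly_prod mult.commute)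

lemma degen_rising_eq_sum_falling:
  "degen_rising l x n = (\<Sum>k\<le>n. hetero_Stirling l n k * falling x k)"
proof -
  have "degen_rising [:l:] [:0, 1:] n
      = (\<Sum>k\<le>n. smult (hetero_Stirling l n k) (falling [:0, 1:] k))"
    using hetero_Stirling_spec[of l] unfolding is_hetero_Stirling_def by blast
  from arg_cong[OF this, of "\<lambda>p. poly p x"] show ?thesis
    by (simp add: poly_falling poly_degen_rising poly_sum)
qed

lemma egf_degen_rising_mult:
  "egf (\<lambda>x. degen_rising l x m * f x) =
    (\<Sum>j\<le>m. fps_const (hetero_Stirling l m j) * (fps_X ^ j * egf (\<lambda>x. f (x + real j))))"
  by (simp add: degen_rising_eq_sum_falling sum_distrib_right mult.assoc egf_sum egf_cmult
      egf_falling_mult)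

text \<open>Dobinski's formula: for constant \<open>f\<close> the shifts in
  \<open>egf_degen_rising_mult\<close> have no effect, and every summand contains the series of
  e^x.\<close>

lemma egf_degen_rising:
  "egf (\<lambda>x. degen_rising l x n) = fps_of_poly (hetero_Bell l n) * fps_exp 1"
proof -
  have "egf (\<lambda>_. 1) = fps_exp 1"
    by (rule fps_ext) (simp add: egf_def)
  then show ?thesis
    using egf_degen_rising_mult[of l n "\<lambda>_. 1"]
    by (simp add: hetero_Bell_def fps_of_poly_sum fps_of_poly_monom sum_distrib_right mult.assoc)
qed

theorem theorem3p1:
  fixes l :: real and m n :: nat
  assumes "l \<noteq> 0"
  shows "hetero_Bell l (n + m) =
    (\<Sum>k\<le>n. \<Sum>j\<le>m.
      smult (real (n choose k) * hetero_Stirling l m j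
               * degen_rising l (real j + real m * l) (n - k))
        (hetero_Bell l k * monom 1 j))"
    (is "_ = ?R")
proof -
  \<comment> \<open>Splitting the argument as x plus \<open>real j + real m * l\<close> makes the
    second Vandermonde factor constant in x, so it leaves \<open>egf\<close> as a scalar.\<close>
  have shift: "egf (\<lambda>x. degen_rising l (x + real j + real m * l) n) =
      (\<Sum>k\<le>n. fps_const (real (n choose k) * degen_rising l (real j + real m * l) (n - k))
        * (fps_of_poly (hetero_Bell l k) * fps_exp 1))" for j
  proof -
    have "degen_rising l (x + real j + real m * l) n =
        (\<Sum>k\<le>n. (real (n choose k) * degen_rising l (real j + real m * l) (n - k))
          * degen_rising l x k)" for x
      using degen_rising_binomial_sum[OF assms, of x "real j + real m * l" n]
      by (simp add: add.assoc mult_ac)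
    then show ?thesis
      by (simp only: egf_sum egf_cmult egf_degen_rising)
  qed
  have "fps_of_poly (hetero_Bell l (n + m)) * fps_exp 1
      = egf (\<lambda>x. degen_rising l x m * degen_rising l (x + real m * l) n)"
    by (simp only: degen_rising_add add.commute[of n m] flip: egf_degen_rising)
  also have "\<dots> = (\<Sum>j\<le>m. \<Sum>k\<le>n. fps_const (hetero_Stirling l m j) * (fps_X ^ j *
      (fps_const (real (n choose k) * degen_rising l (real j + real m * l) (n - k))
        * (fps_of_poly (hetero_Bell l k) * fps_exp 1))))"
    by (simp only: egf_degen_rising_mult shift sum_distrib_left)
  also have "\<dots> = fps_of_poly ?R * fps_exp 1"
    by (subst sum.swap)
      (simp add: fps_of_poly_sum fps_of_poly_smult fps_of_poly_mult fps_of_poly_monom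
        sum_distrib_left sum_distrib_right mult_ac flip: fps_const_mult)
  \<comment> \<open>The nonzero series \<open>fps_exp 1\<close> cancels, and
    \<open>fps_of_poly\<close> is injective.\<close>
  finally show ?thesis
    by (simp add: fps_of_poly_eq_iff)
qed

end
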